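(* Let $(L,\leq,0,1)$ be a bounded lattice and $e\in L\setminus\{0,1\}$. Let $S_e$ be a $t$-conorm on $[e,1]$ and let $U_s: L\times L\to L$ be defined by $$ U_s(x,y)=\begin{cases} S_e(x,y), & (x,y)\in [e,1]^2,\\ x\wedge y, & (x,y)\in ([0,e)\times [e,1])\cup([e,1]\times[0,e))\cup(I_e\times I_e),\\ y, & (x,y)\in [e,1]\times I_e,\\ x, & (x,y)\in I_e\times [e,1],\\ 0, & \text{otherwise.} \end{cases} $$ Then the following statements are equivalent: (i) $U_s$ is a uninorm on $L$ with the neutral element $e$; (ii) either $I_e=\emptyset$, or for any $y,z\in I_e$ it holds that $y\wedge z\in I_e$ or $y\wedge z=0$; (iii) $I_e\wedge I_e\subset I_e\cup\{0\}$; (iv) $\wedge$ is a $t$-norm on $I_e\cup\{0,1\}$.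
   Context: $(L,\leq,0,1)$ is a lattice with bottom element $0$ and top element $1$; $\wedge,\vee$ are infimum and supremum; $x<y$ means $x\leq y$ and $x\neq y$. For $a\leq b$, $[a,b]=\{x\in L: a\leq x\leq b\}$, and $[a,b)$, $(a,b]$, $(a,b)$ are defined similarly (with strict inequality $<$ at the open end). Elements $x,y$ are incomparable, written $x\| y$, if $x\nleq y$ and $y\nleq x$; $I_e=\{x\in L: x\| e\}$. $I_e\wedge I_e=\{y\wedge z: y,z\in I_e\}$. The symbol $\subset$ allows equality. A uninorm on $L$ is a binary operation $U:L^2\to L$ that is commutative, associative, increasing (i.e. order-preserving) in each variable, and has a neutral element $e\in L$, i.e. $U(e,x)=x$ for all $x\in L$. A $t$-norm (resp. $t$-conorm) is a commutative, associative operation, increasing in each variable, whose neutral element is the top (resp. bottom) element. Thus a $t$-conorm on $[e,1]$ is such an operation $[e,1]^2\to[e,1]$ with neutral element $e$. That $\wedge$ is a $t$-norm on $I_e\cup\{0,1\}$ means that the restriction of $\wedge$ to $(I_e\cup\{0,1\})^2$ takes values in $I_e\cup\{0,1\}$ and is commutative, associative, increasing in each variable (for the induced order) with neutral element $1$. *)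

theory Defs
  imports Main
begin

text \<open>
  Operations on a subset \<open>A\<close> of an ordered type are given by total curried functions
  of which only the values on \<open>A \<times> A\<close> matter; monotonicity refers to the induced order.
\<close>

definition uninorm_on :: "'a::order set \<Rightarrow> ('a \<Rightarrow> 'a \<Rightarrow> 'a) \<Rightarrow> 'a \<Rightarrow> bool" where
  "uninorm_on A F u \<longleftrightarrow>
     (\<forall>x\<in>A. \<forall>y\<in>A. F x y \<in> A) \<and>
     (\<forall>x\<in>A. \<forall>y\<in>A. F x y = F y x) \<and>
     (\<forall>x\<in>A. \<forall>y\<in>A. \<forall>z\<in>A. F (F x y) z = F x (F y z)) \<and>
     (\<forall>x\<in>A. \<forall>y\<in>A. \<forall>z\<in>A. x \<le> y \<longrightarrow> F x z \<le> F y z \<and> F z x \<le> F z y) \<and>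
     u \<in> A \<and> (\<forall>x\<in>A. F u x = x)"

definition tnorm_on :: "'a::order set \<Rightarrow> ('a \<Rightarrow> 'a \<Rightarrow> 'a) \<Rightarrow> 'a \<Rightarrow> bool" where
  "tnorm_on A T t \<longleftrightarrow> (\<forall>x\<in>A. x \<le> t) \<and> uninorm_on A T t"

definition tconorm_on :: "'a::order set \<Rightarrow> ('a \<Rightarrow> 'a \<Rightarrow> 'a) \<Rightarrow> 'a \<Rightarrow> bool" where
  "tconorm_on A S b \<longleftrightarrow> (\<forall>x\<in>A. b \<le> x) \<and> uninorm_on A S b"

definition incomparables :: "'a::order \<Rightarrow> 'a set" where
  "incomparables e = {x. \<not> x \<le> e \<and> \<not> e \<le> x}"

definition U\<^sub>s :: "'a::bounded_lattice \<Rightarrow> ('a \<Rightarrow> 'a \<Rightarrow> 'a) \<Rightarrow> 'a \<Rightarrow> 'a \<Rightarrow> 'a" where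
  "U\<^sub>s e S x y =
     (if (x, y) \<in> {e..top} \<times> {e..top} then S x y
      else if (x, y) \<in> {bot..<e} \<times> {e..top} \<union> {e..top} \<times> {bot..<e}
                      \<union> incomparables e \<times> incomparables e then inf x y
      else if (x, y) \<in> {e..top} \<times> incomparables e then y
      else if (x, y) \<in> incomparables e \<times> {e..top} then x
      else bot)"

end

theory Submission
  imports Defs
begin

text \<open>
  The sets \<open>[0,e)\<close>, \<open>[e,1]\<close> and \<open>I\<^sub>e\<close> partition \<open>L\<close>, and on each product of two of them
  \<open>U\<^sub>s\<close> has a single form, so everything but associativity on \<open>I\<^sub>e\<close> holds for every \<open>S\<^sub>e\<close>.
  There a meet \<open>y \<and> z\<close> with \<open>y, z \<in> I\<^sub>e\<close> lies in \<open>I\<^sub>e\<close> or in \<open>[0,e)\<close>; in the latter case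
  \<open>U\<^sub>s (U\<^sub>s y y) z = y \<and> z\<close> whereas \<open>U\<^sub>s y (U\<^sub>s y z) = 0\<close>, so associativity forces
  \<open>y \<and> z = 0\<close>.
\<close>

lemma order_trichotomy_incomparables:
  fixes x e :: "'a::order"
  obtains (below) "x < e" | (above) "e \<le> x" | (incomparable) "x \<in> incomparables e"
  by (auto simp: incomparables_def order.order_iff_strict)

lemma incomparablesD:
  assumes "x \<in> incomparables e"
  shows "\<not> x \<le> e" "\<not> e \<le> x" "\<not> x < e"
  using assms by (auto simp: incomparables_def)

lemma U\<^sub>s_above_above: "e \<le> x \<Longrightarrow> e \<le> y \<Longrightarrow> U\<^sub>s e S x y = S x y"
  by (simp add: U\<^sub>s_def)

text \<open>The meet prescribed on this block collapses to the smaller argument, as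
  \<open>x < e \<le> y\<close>. Hence elements of \<open>{e..top}\<close> act as identities on
  everything outside \<open>{e..top}\<close>.\<close>

lemma U\<^sub>s_below_above: "x < e \<Longrightarrow> e \<le> y \<Longrightarrow> U\<^sub>s e S x y = x"
  by (auto simp: U\<^sub>s_def inf_absorb1)

lemma U\<^sub>s_above_below: "e \<le> x \<Longrightarrow> y < e \<Longrightarrow> U\<^sub>s e S x y = y"
  by (auto simp: U\<^sub>s_def inf_absorb2)

lemma U\<^sub>s_incomparable_incomparable:
  "x \<in> incomparables e \<Longrightarrow> y \<in> incomparables e \<Longrightarrow> U\<^sub>s e S x y = inf x y"
  by (simp add: U\<^sub>s_def incomparablesD)

lemma U\<^sub>s_above_incomparable: "e \<le> x \<Longrightarrow> y \<in> incomparables e \<Longrightarrow> U\<^sub>s e S x y = y"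
  by (auto simp: U\<^sub>s_def incomparables_def)

lemma U\<^sub>s_incomparable_above: "x \<in> incomparables e \<Longrightarrow> e \<le> y \<Longrightarrow> U\<^sub>s e S x y = x"
  by (auto simp: U\<^sub>s_def incomparables_def)

lemma U\<^sub>s_below_below: "x < e \<Longrightarrow> y < e \<Longrightarrow> U\<^sub>s e S x y = bot"
  by (auto simp: U\<^sub>s_def incomparables_def)

lemma U\<^sub>s_below_incomparable: "x < e \<Longrightarrow> y \<in> incomparables e \<Longrightarrow> U\<^sub>s e S x y = bot"
  by (auto simp: U\<^sub>s_def incomparables_def)

lemma U\<^sub>s_incomparable_below: "x \<in> incomparables e \<Longrightarrow> y < e \<Longrightarrow> U\<^sub>s e S x y = bot"
  by (auto simp: U\<^sub>s_def incomparables_def)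

lemmas U\<^sub>s_cases =
  U\<^sub>s_above_above U\<^sub>s_below_above U\<^sub>s_above_below U\<^sub>s_incomparable_incomparable
  U\<^sub>s_above_incomparable U\<^sub>s_incomparable_above U\<^sub>s_below_below U\<^sub>s_below_incomparable
  U\<^sub>s_incomparable_below

text \<open>The third position, \<open>e \<le> inf y z\<close>, would give
  \<open>e \<le> y\<close>.\<close>

lemma inf_incomparables_cases:
  fixes e :: "'a::lattice"
  assumes "y \<in> incomparables e" "z \<in> incomparables e"
  obtains "inf y z \<in> incomparables e" | "inf y z < e"
  using assms by (cases "inf y z" e rule: order_trichotomy_incomparables)
    (auto simp: incomparables_def)

lemma U\<^sub>s_assoc_imp_inf_incomparables:
  fixes e :: "'a::bounded_lattice"
  assumes assoc: "\<And>x y z. U\<^sub>s e S (U\<^sub>s e S x y) z = U\<^sub>s e S x (U\<^sub>s e S y z)"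
    and yz: "y \<in> incomparables e" "z \<in> incomparables e"
  shows "inf y z \<in> incomparables e \<or> inf y z = bot"
  using yz
proof (cases rule: inf_incomparables_cases)
  case 2
  have "inf y z = U\<^sub>s e S (U\<^sub>s e S y y) z"
    using yz by (simp add: U\<^sub>s_cases)
  also have "\<dots> = U\<^sub>s e S y (U\<^sub>s e S y z)"
    by (rule assoc)
  also have "\<dots> = bot"
    using yz 2 by (simp add: U\<^sub>s_cases)
  finally show ?thesis ..
qed simp

text \<open>The hypothesis on meets keeps every intermediate value in a known block: a meet of
  incomparables is again incomparable or is \<open>bot\<close>, which lies below \<open>e\<close>.
  Each axiom then reduces to a finite case check.\<close>

lemma uninorm_on_U\<^sub>s:
  fixes e :: "'a::bounded_lattice"
  assumes e: "e \<noteq> bot"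
    and S: "tconorm_on {e..top} S e"
    and I: "\<And>y z. y \<in> incomparables e \<Longrightarrow> z \<in> incomparables e \<Longrightarrow>
              inf y z \<in> incomparables e \<or> inf y z = bot"
  shows "uninorm_on UNIV (U\<^sub>s e S) e"
proof -
  let ?I = "incomparables e"
  have S_closed: "e \<le> S x y"
    and S_comm: "S x y = S y x"
    and S_neutral: "S e x = x" if "e \<le> x" "e \<le> y" for x y
    using S that by (auto simp: tconorm_on_def uninorm_on_def)
  have S_assoc: "S (S x y) z = S x (S y z)" if "e \<le> x" "e \<le> y" "e \<le> z" for x y z
    using S that by (auto simp: tconorm_on_def uninorm_on_def)
  have S_mono: "S x z \<le> S y z" if "e \<le> x" "e \<le> z" "x \<le> y" for x y z
    using S that order.trans[OF that(1,3)] by (simp add: tconorm_on_def uninorm_on_def)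
  \<comment> \<open>Raising the neutral element \<open>e\<close> to \<open>z\<close> in
    \<open>S e x = x\<close> gives the bound. Monotonicity needs it when the larger argument lies in
    \<open>{e..top}\<close> and the smaller one does not.\<close>
  have S_ge: "x \<le> S x z" if "e \<le> x" "e \<le> z" for x z
    using S_mono[OF order.refl that(1) that(2)] S_comm S_neutral that by simp
  have bot: "bot < e"
    using e by (simp add: bot.not_eq_extremum)
  note U = U\<^sub>s_cases bot S_closed

  have comm: "U\<^sub>s e S x y = U\<^sub>s e S y x" for x y
    by (cases x e rule: order_trichotomy_incomparables;
        cases y e rule: order_trichotomy_incomparables)
      (simp_all add: U inf_commute S_comm)

  \<comment> \<open>Both sides equal the triple meet: if an inner meet is \<open>bot\<close>, the
    outer value is the default \<open>bot\<close>, which is again the meet.\<close>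
  have assoc_incomparable: "U\<^sub>s e S (inf x y) z = U\<^sub>s e S x (inf y z)"
    if "x \<in> ?I" "y \<in> ?I" "z \<in> ?I" for x y z
  proof -
    have "U\<^sub>s e S (inf x y) z = inf (inf x y) z"
      using I[OF that(1,2)] that(3) by (auto simp: U)
    moreover have "U\<^sub>s e S x (inf y z) = inf x (inf y z)"
      using I[OF that(2,3)] that(1) by (auto simp: U)
    ultimately show ?thesis
      by (simp add: inf_assoc)
  qed
  have inf_below: "U\<^sub>s e S (inf x y) z = bot" "U\<^sub>s e S z (inf x y) = bot"
    if "x \<in> ?I" "y \<in> ?I" "z < e" for x y z
    using I[OF that(1,2)] that(3) by (auto simp: U)
  have inf_above: "U\<^sub>s e S (inf x y) z = inf x y" "U\<^sub>s e S z (inf x y) = inf x y"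
    if "x \<in> ?I" "y \<in> ?I" "e \<le> z" for x y z
    using I[OF that(1,2)] that(3) by (auto simp: U)
  have assoc: "U\<^sub>s e S (U\<^sub>s e S x y) z = U\<^sub>s e S x (U\<^sub>s e S y z)" for x y z
    by (cases x e rule: order_trichotomy_incomparables;
        cases y e rule: order_trichotomy_incomparables;
        cases z e rule: order_trichotomy_incomparables)
      (simp_all add: U S_assoc assoc_incomparable inf_below inf_above)

  have mono: "U\<^sub>s e S x z \<le> U\<^sub>s e S y z" if "x \<le> y" for x y z
  proof (cases x e rule: order_trichotomy_incomparables)
    case below
    show ?thesis
    proof (cases z e rule: order_trichotomy_incomparables)
      case above
      then show ?thesis
        using below that
        by (cases y e rule: order_trichotomy_incomparables)
          (auto simp: U intro: order.trans[OF _ S_ge])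
    \<comment> \<open>For \<open>z\<close> outside \<open>{e..top}\<close> the left-hand side is
      \<open>bot\<close>.\<close>
    qed (use below in \<open>simp_all add: U\<close>)
  next
    case above
    then have "e \<le> y"
      using that by (rule order.trans)
    with above show ?thesis
      using that S_mono
      by (cases z e rule: order_trichotomy_incomparables) (simp_all add: U)
  next
    case incomparable
    \<comment> \<open>Otherwise \<open>x \<le> y < e\<close>, against incomparability. In the
      remaining cases the left-hand side is \<open>bot\<close>, \<open>x\<close> or
      \<open>inf x z\<close>.\<close>
    then have "\<not> y < e"
      using that by (auto simp: incomparables_def)
    then show ?thesis
      using incomparable that
      by (cases y e rule: order_trichotomy_incomparables;
          cases z e rule: order_trichotomy_incomparables)
        (auto simp: U intro: order.trans[OF _ S_ge] le_infI1)
  qed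

  have neutral: "U\<^sub>s e S e x = x" for x
    by (cases x e rule: order_trichotomy_incomparables) (simp_all add: U S_neutral)

  show ?thesis
    unfolding uninorm_on_def
  proof (intro conjI ballI impI)
    show "U\<^sub>s e S z x \<le> U\<^sub>s e S z y" if "x \<le> y" for x y z
      using mono[OF that, of z] by (simp only: comm[of z])
    show "U\<^sub>s e S x y = U\<^sub>s e S y x" for x y
      by (rule comm)
  qed (simp_all add: assoc mono neutral)
qed

text \<open>The meet inherits every law from the lattice, so only closure can fail on a
  subset.\<close>

lemma tnorm_on_inf_iff:
  fixes A :: "'a::bounded_lattice set"
  assumes "top \<in> A"
  shows "tnorm_on A inf top \<longleftrightarrow> (\<forall>x\<in>A. \<forall>y\<in>A. inf x y \<in> A)"
proof
  assume "tnorm_on A inf top"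
  then show "\<forall>x\<in>A. \<forall>y\<in>A. inf x y \<in> A"
    unfolding tnorm_on_def uninorm_on_def by (elim conjE)
next
  assume closed: "\<forall>x\<in>A. \<forall>y\<in>A. inf x y \<in> A"
  show "tnorm_on A inf top"
    unfolding tnorm_on_def uninorm_on_def
  proof (intro conjI ballI impI)
    show "inf x y = inf y x" for x y :: 'a by (rule inf_commute)
    show "inf (inf x y) z = inf x (inf y z)" for x y z :: 'a by (rule inf_assoc)
  qed (use assms closed in \<open>auto intro: le_infI1 le_infI2\<close>)
qed

theorem theorem7:
  fixes e :: "'a::bounded_lattice"
    and S\<^sub>e :: "'a \<Rightarrow> 'a \<Rightarrow> 'a"
  assumes "e \<notin> {bot, top}"
    and "tconorm_on {e..top} S\<^sub>e e"
  shows "(uninorm_on UNIV (U\<^sub>s e S\<^sub>e) e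
           \<longleftrightarrow> incomparables e = {} \<or>
               (\<forall>y\<in>incomparables e. \<forall>z\<in>incomparables e.
                  inf y z \<in> incomparables e \<or> inf y z = bot))
       \<and> (uninorm_on UNIV (U\<^sub>s e S\<^sub>e) e
           \<longleftrightarrow> {inf y z | y z. y \<in> incomparables e \<and> z \<in> incomparables e}
               \<subseteq> incomparables e \<union> {bot})
       \<and> (uninorm_on UNIV (U\<^sub>s e S\<^sub>e) e
           \<longleftrightarrow> tnorm_on (incomparables e \<union> {bot, top}) inf top)"
proof -
  let ?I = "incomparables e" and ?U = "uninorm_on UNIV (U\<^sub>s e S\<^sub>e) e"
  let ?closed = "\<forall>y\<in>?I. \<forall>z\<in>?I. inf y z \<in> ?I \<or> inf y z = bot"
  \<comment> \<open>The alternative \<open>?I = {}\<close> is absorbed here, since it makes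
    \<open>?closed\<close> vacuous.\<close>
  have U: "?U \<longleftrightarrow> ?closed"
  proof
    assume ?U
    then have "\<forall>x\<in>UNIV. \<forall>y\<in>UNIV. \<forall>z\<in>UNIV.
        U\<^sub>s e S\<^sub>e (U\<^sub>s e S\<^sub>e x y) z = U\<^sub>s e S\<^sub>e x (U\<^sub>s e S\<^sub>e y z)"
      unfolding uninorm_on_def by (elim conjE)
    then have "U\<^sub>s e S\<^sub>e (U\<^sub>s e S\<^sub>e x y) z = U\<^sub>s e S\<^sub>e x (U\<^sub>s e S\<^sub>e y z)" for x y z
      by (simp only: ball_UNIV)
    then show ?closed
      by (intro ballI U\<^sub>s_assoc_imp_inf_incomparables)
  next
    assume ?closed
    then show ?U
      using assms by (intro uninorm_on_U\<^sub>s) auto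
  qed
  \<comment> \<open>A meet equal to \<open>top\<close> would force \<open>y = top\<close>, which is
    comparable to \<open>e\<close>. So adjoining \<open>top\<close> to the set admits no new value
    for meets of incomparables.\<close>
  have not_top: "inf y z \<noteq> top" if "y \<in> ?I" for y z
    using that by (auto simp: incomparables_def)
  have "?closed \<longleftrightarrow> (\<forall>x\<in>?I \<union> {bot, top}. \<forall>y\<in>?I \<union> {bot, top}. inf x y \<in> ?I \<union> {bot, top})"
    (is "_ \<longleftrightarrow> ?closed'")
  proof
    assume ?closed
    then have "inf x y \<in> ?I \<union> {bot, top}" if "x \<in> ?I" "y \<in> ?I" for x y
      using that by blast
    then show ?closed'
      by (intro ballI) (elim UnE insertE emptyE; simp)
  next
    assume ?closed'
    then have "inf y z \<in> ?I \<union> {bot, top}" if "y \<in> ?I" "z \<in> ?I" for y z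
      using that by blast
    then show ?closed
      using not_top by blast
  qed
  also have "\<dots> \<longleftrightarrow> tnorm_on (?I \<union> {bot, top}) inf top"
    by (rule tnorm_on_inf_iff[symmetric]) simp
  finally have tnorm: "?closed \<longleftrightarrow> tnorm_on (?I \<union> {bot, top}) inf top" .
  have "?closed \<longleftrightarrow> {inf y z | y z. y \<in> ?I \<and> z \<in> ?I} \<subseteq> ?I \<union> {bot}"
    by blast
  with U tnorm show ?thesis
    by blast
qed

end
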